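(* There is a universal constant $c>0$ such that the following holds. Let $\mu$ be a probability distribution supported on $\Omega=\{\pm1\}^n$ and $\{q_i:\Omega\to\mathbb{R}_+\}_{i\in[n]}$ be transition rates reversible for $\mu$. Let $\{w_i:\Omega\to\mathbb{R}_+\}_{i\in[n]}$ be weight functions that are $b$-bounded for some $b\in(0,1]$. Assume that $0$-CSGE holds with constant $\rho_{\mathrm{CSGE}}\in\mathbb{R}$ and that the log-Sobolev inequality holds with constant $\rho_{\mathrm{LSI}}>0$. Let $\kappa_0=\max\{-\rho_{\mathrm{CSGE}},0\}$. Then for any $f:\Omega\to\mathbb{R}$, $$c\,\mathrm{Var}_\mu(f)\le\frac{\rho_{\mathrm{LSI}}+\kappa_0}{b\,\rho_{\mathrm{LSI}}^2}\sum_{i=1}^n\frac{I_{w,i}(f)}{1+\log\left(\sqrt{I_{w,i}(f)}\,/\,\mathbb{E}_\mu[|\delta_{w,i}|f]\right)},$$ where a summand is interpreted as zero when $I_{w,i}(f)=0$. Furthermore, $$I(f)\ge c\,\frac{b^2\rho_{\mathrm{LSI}}^2}{\rho_{\mathrm{LSI}}+\kappa_0}\,\mathrm{Var}_\mu(f)\left(1+\log\frac{I_w(f)}{J_w(f)}\right).$$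
   Context: $x^i$ is $x\in\Omega$ with the $i$-th coordinate flipped. Generator: $Lf(x)=\sum_{i=1}^nq_i(x)(f(x^i)-f(x))$; $P_t=e^{tL}$. Reversible for $\mu$: $\mu(x)q_i(x)=\mu(x^i)q_i(x^i)$ for all $x,i$. $b$-bounded weights: $b\le w_i(x)\le1/b$ for all $x,i$. $\delta_{w,i}f(x)=\sqrt{\frac12w_i(x)q_i(x)}\,(f(x^i)-f(x))$; $\nabla_wf=(\delta_{w,1}f,\dots,\delta_{w,n}f)$; $|\delta_{w,i}|f=|\delta_{w,i}f|$; $|\nabla_w|f=(|\delta_{w,1}|f,\dots,|\delta_{w,n}|f)$. $\Gamma_w(f)=\|\nabla_wf\|_2^2$, and $\Gamma(f)$ is $\Gamma_w(f)$ with $w\equiv1$. Influences: $I_{w,i}(f)=\mathbb{E}_\mu[(\delta_{w,i}f)^2]$; $I_w(f)=\sum_iI_{w,i}(f)$; $I(f)=\mathbb{E}_\mu[\Gamma(f)]$ (unweighted); $J_w(f)=\sum_{i=1}^n(\mathbb{E}_\mu[|\delta_{w,i}|f])^2$. $0$-CSGE with constant $\rho$: for all $f:\Omega\to\mathbb{R}$ and $t\ge0$, pointwise, $\|\nabla_wP_tf\|_2\le e^{-\rho t}\|P_t|\nabla_w|f\|_2$, where $P_t$ acts entrywise on vector fields. Log-Sobolev inequality with constant $\rho$: $\mathrm{Ent}_\mu[f^2]\le\frac2\rho\mathbb{E}_\mu[\Gamma(f)]$ for all $f:\Omega\to\mathbb{R}$, where $\mathrm{Ent}_\mu[g]=\mathbb{E}_\mu[g\log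 g]-\mathbb{E}_\mu[g]\log\mathbb{E}_\mu[g]$. $\log$ is natural. The right-hand side of the second inequality is $0$ when $\mathrm{Var}_\mu(f)=0$. *)

theory Defs
  imports "HOL-Probability.Probability"
begin

text \<open>
  The dimension is an explicit natural number, not a type, so that a constant can be quantified
  outside of it. Functions on the cube are total functions on \<^typ>\<open>nat \<Rightarrow> int\<close>; every notion
  below only uses their values on \<open>cube n\<close>, which \<open>flip i\<close> preserves for \<open>i \<in> {1..n}\<close>.
\<close>

type_synonym config = "nat \<Rightarrow> int"

definition cube :: "nat \<Rightarrow> config set" where
  "cube n = {1..n} \<rightarrow>\<^sub>E {-1, 1}"

definition flip :: "nat \<Rightarrow> config \<Rightarrow> config" where
  "flip i x = x(i := - x i)"

definition gen :: "nat \<Rightarrow> (nat \<Rightarrow> config \<Rightarrow> real) \<Rightarrow> (config \<Rightarrow> real) \<Rightarrow> config \<Rightarrow> real" where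
  "gen n q f x = (\<Sum>i=1..n. q i x * (f (flip i x) - f x))"

text \<open>The operator exponential of \<open>t L\<close>; the series converges on the finite set \<open>cube n\<close>.\<close>

definition semigroup_op ::
  "nat \<Rightarrow> (nat \<Rightarrow> config \<Rightarrow> real) \<Rightarrow> real \<Rightarrow> (config \<Rightarrow> real) \<Rightarrow> config \<Rightarrow> real" where
  "semigroup_op n q t f x = (\<Sum>k. t ^ k / fact k * (gen n q ^^ k) f x)"

definition reversible :: "nat \<Rightarrow> config pmf \<Rightarrow> (nat \<Rightarrow> config \<Rightarrow> real) \<Rightarrow> bool" where
  "reversible n \<mu> q \<longleftrightarrow>
     (\<forall>i\<in>{1..n}. \<forall>x\<in>cube n. pmf \<mu> x * q i x = pmf \<mu> (flip i x) * q i (flip i x))"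

definition b_bounded :: "nat \<Rightarrow> (nat \<Rightarrow> config \<Rightarrow> real) \<Rightarrow> real \<Rightarrow> bool" where
  "b_bounded n w b \<longleftrightarrow> (\<forall>i\<in>{1..n}. \<forall>x\<in>cube n. b \<le> w i x \<and> w i x \<le> 1 / b)"

definition wdelta ::
  "(nat \<Rightarrow> config \<Rightarrow> real) \<Rightarrow> (nat \<Rightarrow> config \<Rightarrow> real) \<Rightarrow> nat \<Rightarrow> (config \<Rightarrow> real) \<Rightarrow> config \<Rightarrow> real" where
  "wdelta q w i f x = sqrt (1 / 2 * w i x * q i x) * (f (flip i x) - f x)"

definition abs_wdelta ::
  "(nat \<Rightarrow> config \<Rightarrow> real) \<Rightarrow> (nat \<Rightarrow> config \<Rightarrow> real) \<Rightarrow> nat \<Rightarrow> (config \<Rightarrow> real) \<Rightarrow> config \<Rightarrow> real" where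
  "abs_wdelta q w i f x = \<bar>wdelta q w i f x\<bar>"

definition wGamma ::
  "nat \<Rightarrow> (nat \<Rightarrow> config \<Rightarrow> real) \<Rightarrow> (nat \<Rightarrow> config \<Rightarrow> real) \<Rightarrow> (config \<Rightarrow> real) \<Rightarrow> config \<Rightarrow> real" where
  "wGamma n q w f x = (L2_set (\<lambda>i. wdelta q w i f x) {1..n})\<^sup>2"

abbreviation Gamma_op ::
  "nat \<Rightarrow> (nat \<Rightarrow> config \<Rightarrow> real) \<Rightarrow> (config \<Rightarrow> real) \<Rightarrow> config \<Rightarrow> real" where
  "Gamma_op n q \<equiv> wGamma n q (\<lambda>i x. 1)"

definition influence ::
  "config pmf \<Rightarrow> (nat \<Rightarrow> config \<Rightarrow> real) \<Rightarrow> (nat \<Rightarrow> config \<Rightarrow> real) \<Rightarrow> nat \<Rightarrow> (config \<Rightarrow> real) \<Rightarrow> real" where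
  "influence \<mu> q w i f = measure_pmf.expectation \<mu> (\<lambda>x. (wdelta q w i f x)\<^sup>2)"

definition weighted_influence ::
  "nat \<Rightarrow> config pmf \<Rightarrow> (nat \<Rightarrow> config \<Rightarrow> real) \<Rightarrow> (nat \<Rightarrow> config \<Rightarrow> real) \<Rightarrow> (config \<Rightarrow> real) \<Rightarrow> real" where
  "weighted_influence n \<mu> q w f = (\<Sum>i=1..n. influence \<mu> q w i f)"

definition total_influence ::
  "nat \<Rightarrow> config pmf \<Rightarrow> (nat \<Rightarrow> config \<Rightarrow> real) \<Rightarrow> (config \<Rightarrow> real) \<Rightarrow> real" where
  "total_influence n \<mu> q f = measure_pmf.expectation \<mu> (Gamma_op n q f)"

definition l1_influence_sq ::
  "nat \<Rightarrow> config pmf \<Rightarrow> (nat \<Rightarrow> config \<Rightarrow> real) \<Rightarrow> (nat \<Rightarrow> config \<Rightarrow> real) \<Rightarrow> (config \<Rightarrow> real) \<Rightarrow> real" where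
  "l1_influence_sq n \<mu> q w f =
     (\<Sum>i=1..n. (measure_pmf.expectation \<mu> (abs_wdelta q w i f))\<^sup>2)"

definition CSGE0 ::
  "nat \<Rightarrow> (nat \<Rightarrow> config \<Rightarrow> real) \<Rightarrow> (nat \<Rightarrow> config \<Rightarrow> real) \<Rightarrow> real \<Rightarrow> bool" where
  "CSGE0 n q w \<rho> \<longleftrightarrow>
     (\<forall>f. \<forall>t\<ge>0. \<forall>x\<in>cube n.
        L2_set (\<lambda>i. wdelta q w i (semigroup_op n q t f) x) {1..n}
        \<le> exp (- \<rho> * t) * L2_set (\<lambda>i. semigroup_op n q t (abs_wdelta q w i f) x) {1..n})"

text \<open>Since \<^term>\<open>ln (0::real)\<close> is multiplied by \<open>0\<close>, the convention \<open>0 log 0 = 0\<close> is built in.\<close>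

definition Ent :: "config pmf \<Rightarrow> (config \<Rightarrow> real) \<Rightarrow> real" where
  "Ent \<mu> g = measure_pmf.expectation \<mu> (\<lambda>x. g x * ln (g x))
     - measure_pmf.expectation \<mu> g * ln (measure_pmf.expectation \<mu> g)"

definition log_sobolev ::
  "nat \<Rightarrow> config pmf \<Rightarrow> (nat \<Rightarrow> config \<Rightarrow> real) \<Rightarrow> real \<Rightarrow> bool" where
  "log_sobolev n \<mu> q \<rho> \<longleftrightarrow>
     (\<forall>f. Ent \<mu> (\<lambda>x. (f x)\<^sup>2) \<le> 2 / \<rho> * measure_pmf.expectation \<mu> (Gamma_op n q f))"

end

theory Submission
  imports Defs
begin

text \<open>
  The proof is Talagrand's semigroup argument. Along the semigroup the variance is lost at rate
  \<open>2 E (\<Gamma> (P\<^sub>t f))\<close>, and up to the factor \<open>b\<close> and the growth \<open>exp (2 \<kappa> t)\<close> the commutation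
  hypothesis bounds this rate by the sum over \<open>i\<close> of \<open>E ((P\<^sub>t g\<^sub>i)\<^sup>2)\<close>, where
  \<open>g\<^sub>i = |\<delta>\<^sub>i| f\<close>. So it remains to see that these second moments decay, and faster the
  smaller the \<open>L\<^sup>1\<close> norm of \<open>g\<^sub>i\<close> is compared to its \<open>L\<^sup>2\<close> norm. This is usually
  read off from hypercontractivity and interpolation. The log-Sobolev inequality gives it directly.

  For \<open>h \<ge> 0\<close> with \<open>m = E h\<close> and \<open>u = E (h\<^sup>2)\<close>, convexity gives
  \<open>Ent (h\<^sup>2) \<ge> u ln (u / m\<^sup>2)\<close> (lemma \<open>entropy_square_ge\<close>). Apply it to
  \<open>h = P\<^sub>t g\<close> with \<open>g \<ge> 0\<close>: the mean \<open>m\<close> does not depend on \<open>t\<close> and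
  \<open>u' = - 2 E (\<Gamma> (P\<^sub>t g)) \<le> - \<rho> u ln (u / m\<^sup>2)\<close>. Hence \<open>ln (u / m\<^sup>2)\<close> shrinks by
  the factor \<open>exp (- \<rho> t)\<close>, so \<open>u t \<le> u 0 exp (- \<rho> t l)\<close> for \<open>\<rho> t \<le> 1\<close>, where
  \<open>l = ln (\<surd>(u 0) / m)\<close> (lemma \<open>E_square_semigroup_l1_l2\<close>). The same entropy bound
  for \<open>h = 1 + \<epsilon> (f - E f)\<close> is a Poincare inequality (lemma \<open>poincare\<close>), so that up to
  the time \<open>T = 1 / (\<rho> + \<kappa>)\<close> a fraction of order \<open>\<rho> / (\<rho> + \<kappa>)\<close> of the variance is lost,
  while \<open>exp (2 \<kappa> t)\<close> stays bounded. Integrating the decay of the \<open>i\<close>-th term over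
  \<open>[0, T]\<close> costs the factor \<open>1 / (\<rho> (1 + l\<^sub>i))\<close>, and this is the first inequality
  (theorem \<open>variance_le_sum_influences\<close>).

  The second inequality follows from the first by a Jensen-type bound on
  \<open>\<Sum>i. I\<^sub>i / (1 + l\<^sub>i)\<close> in terms of \<open>\<Sum>i. I\<^sub>i\<close> and \<open>\<Sum>i. I\<^sub>i exp (- 2 l\<^sub>i)\<close>
  (lemma \<open>sum_influence_ratio_le\<close>).
\<close>

section \<open>Real analysis\<close>

lemma differential_decay:
  fixes y y' :: "real \<Rightarrow> real" and \<rho> t :: real
  assumes deriv: "\<And>s. s \<ge> 0 \<Longrightarrow> (y has_real_derivative y' s) (at s)"
    and decay: "\<And>s. s \<ge> 0 \<Longrightarrow> y' s \<le> - \<rho> * y s"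
    and t: "t \<ge> 0"
  shows "y t \<le> exp (- \<rho> * t) * y 0"
proof -
  have "exp (\<rho> * t) * y t \<le> exp (\<rho> * 0) * y 0"
  proof (rule DERIV_nonpos_imp_nonincreasing[OF t])
    fix s :: real assume s: "0 \<le> s" "s \<le> t"
    have "((\<lambda>s. exp (\<rho> * s) * y s) has_real_derivative exp (\<rho> * s) * (\<rho> * y s + y' s)) (at s)"
      by (auto intro!: derivative_eq_intros deriv s simp: algebra_simps)
    moreover have "exp (\<rho> * s) * (\<rho> * y s + y' s) \<le> 0"
      using decay[OF s(1)] by (intro mult_nonneg_nonpos) auto
    ultimately show "\<exists>d. ((\<lambda>s. exp (\<rho> * s) * y s) has_real_derivative d) (at s) \<and> d \<le> 0"
      by blast
  qed
  hence "exp (- \<rho> * t) * (exp (\<rho> * t) * y t) \<le> exp (- \<rho> * t) * y 0" by simp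
  thus ?thesis by (simp add: mult.assoc[symmetric] exp_add[symmetric])
qed

lemma one_minus_exp_ge_half:
  fixes y :: real
  assumes "0 \<le> y" "y \<le> 1"
  shows "y / 2 \<le> 1 - exp (- y)"
proof -
  have "1 + y \<le> exp y" by (rule exp_ge_add_one_self)
  hence "exp (- y) \<le> 1 / (1 + y)"
    using assms by (simp add: exp_minus field_simps)
  also have "\<dots> \<le> 1 - y / 2"
  proof -
    have "y * y \<le> y" using assms by (simp add: mult_left_le)
    thus ?thesis using assms by (simp add: field_simps)
  qed
  finally show ?thesis by simp
qed

text \<open>
  This turns the logarithm of the entropy bound into the linear term of the Poincare inequality,
  for a perturbation of any size.
\<close>

lemma self_le_one_plus_mult_ln:
  fixes s :: real
  assumes "s \<ge> 0"
  shows "s \<le> (1 + s) * ln (1 + s)"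
proof -
  have "ln (1 / (1 + s)) \<le> 1 / (1 + s) - 1"
    using assms by (intro ln_le_minus_one) auto
  hence "s / (1 + s) \<le> ln (1 + s)"
    using assms by (simp add: ln_div field_simps)
  thus ?thesis using assms by (simp add: field_simps)
qed

text \<open>
  The function is twice the squared negative part. It is continuously differentiable with monotone
  derivative, so its mean can be followed along the semigroup, which proves positivity.
\<close>

lemma has_derivative_square_minus_mult_abs:
  "((\<lambda>y::real. y\<^sup>2 - y * \<bar>y\<bar>) has_real_derivative 2 * y - 2 * \<bar>y\<bar>) (at y)"
proof (cases "y = 0")
  case True
  have "((\<lambda>h::real. h * \<bar>h\<bar> / h) \<longlongrightarrow> 0) (at 0)"
  proof (rule Lim_transform_eventually)
    show "((\<lambda>h::real. \<bar>h\<bar>) \<longlongrightarrow> 0) (at 0)"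
      using tendsto_rabs[OF tendsto_ident_at, of 0 UNIV] by simp
    show "\<forall>\<^sub>F h in at (0::real). \<bar>h\<bar> = h * \<bar>h\<bar> / h"
      by (auto simp: eventually_at_filter)
  qed
  hence "((\<lambda>y::real. y * \<bar>y\<bar>) has_real_derivative 0) (at 0)"
    by (simp add: DERIV_def)
  from DERIV_diff[OF DERIV_power[OF DERIV_ident, of 2] this]
  have "((\<lambda>y::real. y\<^sup>2 - y * \<bar>y\<bar>) has_real_derivative 0) (at 0)" by simp
  thus ?thesis using True by simp
next
  case False
  then consider "y > 0" | "y < 0" by linarith
  thus ?thesis
  proof cases
    case 1
    have "((\<lambda>y::real. y\<^sup>2 - y * \<bar>y\<bar>) has_real_derivative 0) (at y)"
      by (rule has_field_derivative_transform_within_open[of "\<lambda>y. 0" _ _ "{0<..}"])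
         (use 1 in \<open>auto simp: power2_eq_square\<close>)
    thus ?thesis using 1 by simp
  next
    case 2
    have "((\<lambda>y::real. 2 * y\<^sup>2) has_real_derivative 4 * y) (at y)"
      by (auto intro!: derivative_eq_intros)
    hence "((\<lambda>y::real. y\<^sup>2 - y * \<bar>y\<bar>) has_real_derivative 4 * y) (at y)"
      by (rule has_field_derivative_transform_within_open[of _ _ _ "{..<0}"])
         (use 2 in \<open>auto simp: power2_eq_square\<close>)
    thus ?thesis using 2 by simp
  qed
qed

lemma DERIV_exponential_series:
  fixes a :: "nat \<Rightarrow> real" and C M t :: real
  assumes bound: "\<And>k. \<bar>a k\<bar> \<le> M * C ^ k"
  shows "summable (\<lambda>k. t ^ k / fact k * a k)"
    and "((\<lambda>s. \<Sum>k. s ^ k / fact k * a k) has_real_derivative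
           (\<Sum>k. t ^ k / fact k * a (Suc k))) (at t)"
proof -
  define c where "c k = a k / fact k" for k
  have sm: "summable (\<lambda>k. c k * s ^ k)" for s
  proof (rule summable_comparison_test')
    have "summable (\<lambda>k. inverse (fact k) * (C * \<bar>s\<bar>) ^ k)"
      by (rule summable_exp)
    from summable_mult[OF this, of M]
    show "summable (\<lambda>k. M * (inverse (fact k) * (C * \<bar>s\<bar>) ^ k))" .
    fix k :: nat
    have "norm (c k * s ^ k) = \<bar>a k\<bar> * (\<bar>s\<bar> ^ k / fact k)"
      by (simp add: c_def abs_mult power_abs)
    also have "\<dots> \<le> M * C ^ k * (\<bar>s\<bar> ^ k / fact k)"
      by (intro mult_right_mono bound) auto
    finally show "norm (c k * s ^ k) \<le> M * (inverse (fact k) * (C * \<bar>s\<bar>) ^ k)"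
      by (simp add: power_mult_distrib field_simps)
  qed
  show "summable (\<lambda>k. t ^ k / fact k * a k)"
    using sm[of t] by (simp add: c_def field_simps)
  have "((\<lambda>s. \<Sum>k. c k * s ^ k) has_real_derivative (\<Sum>k. diffs c k * t ^ k)) (at t)"
    by (rule termdiffs_strong_converges_everywhere) (rule sm)
  moreover have "diffs c k * t ^ k = t ^ k / fact k * a (Suc k)" for k
    by (simp add: diffs_def c_def field_simps del: of_nat_Suc)
  moreover have "c k * s ^ k = s ^ k / fact k * a k" for k s
    by (simp add: c_def)
  ultimately show "((\<lambda>s. \<Sum>k. s ^ k / fact k * a k) has_real_derivative
           (\<Sum>k. t ^ k / fact k * a (Suc k))) (at t)" by simp
qed

section \<open>Entropy\<close>

text \<open>
  With \<open>\<nu>\<close> the measure of density \<open>h\<^sup>2 / u\<close>, this is Jensen's inequality for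
  \<open>- ln\<close> and the random variable \<open>1 / h\<close> under \<open>\<nu>\<close>. The proof replaces Jensen by
  the tangent of the logarithm at the point where \<open>h\<close> equals \<open>c = u / m\<close>; for this \<open>c\<close>
  the linear terms cancel after integration.
\<close>

lemma entropy_square_ge:
  fixes \<mu> :: "config pmf" and h :: "config \<Rightarrow> real"
  assumes fin: "finite (set_pmf \<mu>)"
    and nonneg: "\<And>x. x \<in> set_pmf \<mu> \<Longrightarrow> 0 \<le> h x"
    and m: "0 < measure_pmf.expectation \<mu> h"
    and u: "0 < measure_pmf.expectation \<mu> (\<lambda>x. (h x)\<^sup>2)"
  shows "measure_pmf.expectation \<mu> (\<lambda>x. (h x)\<^sup>2) *
           ln (measure_pmf.expectation \<mu> (\<lambda>x. (h x)\<^sup>2) / (measure_pmf.expectation \<mu> h)\<^sup>2)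
         \<le> Ent \<mu> (\<lambda>x. (h x)\<^sup>2)"
proof -
  note int[simp] = integrable_measure_pmf_finite[OF fin]
  define m where "m = measure_pmf.expectation \<mu> h"
  define u where "u = measure_pmf.expectation \<mu> (\<lambda>x. (h x)\<^sup>2)"
  define c where "c = u / m"
  have pos: "m > 0" "u > 0" "c > 0" using assms by (auto simp: m_def u_def c_def)
  have "2 * (h x)\<^sup>2 - 2 * c * h x + (h x)\<^sup>2 * ln (c\<^sup>2) \<le> (h x)\<^sup>2 * ln ((h x)\<^sup>2)"
    if "x \<in> set_pmf \<mu>" for x
  proof (cases "h x = 0")
    case False
    hence hx: "h x > 0" using nonneg[OF that] by simp
    have "ln (c / h x) \<le> c / h x - 1"
      using hx pos by (intro ln_le_minus_one) auto
    hence "1 - c / h x \<le> ln (h x) - ln c"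
      using hx pos by (simp add: ln_div)
    hence "(2 * (h x)\<^sup>2) * (1 - c / h x) \<le> (2 * (h x)\<^sup>2) * (ln (h x) - ln c)"
      by (intro mult_left_mono) auto
    moreover have "(2 * (h x)\<^sup>2) * (1 - c / h x) = 2 * (h x)\<^sup>2 - 2 * c * h x"
      using hx by (simp add: field_simps power2_eq_square)
    ultimately show ?thesis
      using hx pos by (simp add: ln_realpow algebra_simps)
  qed simp
  hence "measure_pmf.expectation \<mu> (\<lambda>x. 2 * (h x)\<^sup>2 - 2 * c * h x + (h x)\<^sup>2 * ln (c\<^sup>2))
       \<le> measure_pmf.expectation \<mu> (\<lambda>x. (h x)\<^sup>2 * ln ((h x)\<^sup>2))"
    by (intro integral_mono_AE) (auto simp: AE_measure_pmf_iff)
  moreover have "measure_pmf.expectation \<mu> (\<lambda>x. 2 * (h x)\<^sup>2 - 2 * c * h x + (h x)\<^sup>2 * ln (c\<^sup>2))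
      = 2 * u - 2 * c * m + u * ln (c\<^sup>2)"
    by (simp add: u_def m_def)
  moreover have "2 * u - 2 * c * m = 0" using pos by (simp add: c_def)
  moreover have "u * ln (c\<^sup>2) - u * ln u = u * ln (u / m\<^sup>2)"
    using pos by (simp add: c_def ln_div ln_realpow algebra_simps)
  ultimately show ?thesis
    unfolding Ent_def u_def[symmetric] m_def[symmetric] by linarith
qed

section \<open>Reversible dynamics on the cube\<close>

lemma finite_cube: "finite (cube n)"
  by (simp add: cube_def finite_PiE)

lemma flip_in_cube:
  assumes "i \<in> {1..n}" "x \<in> cube n"
  shows "flip i x \<in> cube n"
  using assms by (fastforce simp: cube_def flip_def PiE_iff extensional_def)

lemma flip_flip: "flip i (flip i x) = x"
  by (simp add: flip_def)

locale reversible_cube =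
  fixes n :: nat and \<mu> :: "config pmf" and q :: "nat \<Rightarrow> config \<Rightarrow> real"
  assumes support: "set_pmf \<mu> \<subseteq> cube n"
    and rate_nonneg: "\<And>i x. i \<in> {1..n} \<Longrightarrow> x \<in> cube n \<Longrightarrow> 0 \<le> q i x"
    and rev: "reversible n \<mu> q"
begin

abbreviation E :: "(config \<Rightarrow> real) \<Rightarrow> real" where
  "E \<equiv> measure_pmf.expectation \<mu>"

abbreviation P :: "real \<Rightarrow> (config \<Rightarrow> real) \<Rightarrow> config \<Rightarrow> real" where
  "P \<equiv> semigroup_op n q"

lemma finite_support: "finite (set_pmf \<mu>)"
  using support finite_cube by (rule finite_subset)

lemma integrable: "integrable (measure_pmf \<mu>) (g :: config \<Rightarrow> real)"
  by (rule integrable_measure_pmf_finite[OF finite_support])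

lemma E_sum: "E g = (\<Sum>x\<in>cube n. pmf \<mu> x * g x)"
proof -
  have "E g = (\<Sum>x\<in>cube n. g x * pmf \<mu> x)"
    by (rule integral_measure_pmf_real[OF finite_cube]) (use support in auto)
  thus ?thesis by (simp add: mult.commute)
qed

lemma E_mono:
  assumes "\<And>x. x \<in> cube n \<Longrightarrow> f x \<le> g x"
  shows "E f \<le> E g"
  unfolding E_sum by (intro sum_mono mult_left_mono assms) auto

lemma E_cong:
  assumes "\<And>x. x \<in> cube n \<Longrightarrow> f x = g x"
  shows "E f = E g"
  unfolding E_sum by (intro sum.cong) (auto simp: assms)

lemma E_nonneg:
  assumes "\<And>x. x \<in> cube n \<Longrightarrow> 0 \<le> f x"
  shows "0 \<le> E f"
  unfolding E_sum by (intro sum_nonneg mult_nonneg_nonneg assms) auto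

lemma variance_eq: "measure_pmf.variance \<mu> f = E (\<lambda>x. (f x)\<^sup>2) - (E f)\<^sup>2"
  by (rule measure_pmf.variance_eq) (rule integrable)+

lemma square_E_le: "(E f)\<^sup>2 \<le> E (\<lambda>x. (f x)\<^sup>2)"
  using variance_eq[of f] E_nonneg[of "\<lambda>x. (f x - E f)\<^sup>2"] by simp

lemma sum_flip:
  assumes "i \<in> {1..n}"
  shows "(\<Sum>x\<in>cube n. g (flip i x)) = (\<Sum>x\<in>cube n. g x)"
  by (rule sum.reindex_bij_witness[of _ "flip i" "flip i"])
     (use assms in \<open>auto simp: flip_flip flip_in_cube\<close>)

text \<open>
  Summation by parts: reversibility makes \<open>\<mu> q\<^sub>i\<close> invariant under the flip, so exchanging
  \<open>x\<close> and \<open>flip i x\<close> symmetrizes the left-hand side.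
\<close>

lemma dirichlet_form:
  "E (\<lambda>x. \<phi> x * gen n q g x) =
     - (1/2) * (\<Sum>i=1..n. E (\<lambda>x. q i x * ((\<phi> (flip i x) - \<phi> x) * (g (flip i x) - g x))))"
proof -
  have one: "E (\<lambda>x. \<phi> x * (q i x * (g (flip i x) - g x))) =
     - (1/2) * E (\<lambda>x. q i x * ((\<phi> (flip i x) - \<phi> x) * (g (flip i x) - g x)))"
    if i: "i \<in> {1..n}" for i
  proof -
    have "E (\<lambda>x. \<phi> x * (q i x * (g (flip i x) - g x)))
        = (\<Sum>x\<in>cube n. pmf \<mu> (flip i x) *
             (\<phi> (flip i x) * (q i (flip i x) * (g (flip i (flip i x)) - g (flip i x)))))"
      unfolding E_sum by (rule sum_flip[OF i, symmetric])
    also have "\<dots> = (\<Sum>x\<in>cube n. pmf \<mu> x * (- (q i x * \<phi> (flip i x) * (g (flip i x) - g x))))"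
    proof (intro sum.cong refl)
      fix x assume "x \<in> cube n"
      hence "pmf \<mu> (flip i x) * q i (flip i x) = pmf \<mu> x * q i x"
        using rev i by (auto simp: reversible_def)
      hence "pmf \<mu> (flip i x) * q i (flip i x) * (\<phi> (flip i x) * (g x - g (flip i x)))
           = pmf \<mu> x * q i x * (\<phi> (flip i x) * (g x - g (flip i x)))" by simp
      thus "pmf \<mu> (flip i x) *
             (\<phi> (flip i x) * (q i (flip i x) * (g (flip i (flip i x)) - g (flip i x))))
          = pmf \<mu> x * (- (q i x * \<phi> (flip i x) * (g (flip i x) - g x)))"
        by (simp add: flip_flip algebra_simps)
    qed
    finally have sym: "E (\<lambda>x. \<phi> x * (q i x * (g (flip i x) - g x)))
        = E (\<lambda>x. - (q i x * \<phi> (flip i x) * (g (flip i x) - g x)))"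
      by (simp only: E_sum)
    have "E (\<lambda>x. q i x * ((\<phi> (flip i x) - \<phi> x) * (g (flip i x) - g x)))
       = - E (\<lambda>x. - (q i x * \<phi> (flip i x) * (g (flip i x) - g x)))
         - E (\<lambda>x. \<phi> x * (q i x * (g (flip i x) - g x)))"
      unfolding E_sum
      by (simp add: sum_negf[symmetric] sum_subtractf[symmetric] algebra_simps)
    thus ?thesis using sym by simp
  qed
  have "E (\<lambda>x. \<phi> x * gen n q g x) = (\<Sum>i=1..n. E (\<lambda>x. \<phi> x * (q i x * (g (flip i x) - g x))))"
    by (simp add: gen_def sum_distrib_left integrable)
  also have "\<dots> = (\<Sum>i=1..n. - (1/2) *
      E (\<lambda>x. q i x * ((\<phi> (flip i x) - \<phi> x) * (g (flip i x) - g x))))"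
    by (intro sum.cong refl one)
  finally show ?thesis by (simp add: sum_distrib_left)
qed

lemma E_mono_mult_gen_nonpos:
  assumes "mono \<phi>"
  shows "E (\<lambda>x. \<phi> (g x) * gen n q g x) \<le> 0"
proof -
  have "0 \<le> (\<phi> a - \<phi> b) * (a - b)" for a b :: real
    using monoD[OF assms, of a b] monoD[OF assms, of b a]
    by (cases "a \<le> b") (simp_all add: zero_le_mult_iff)
  hence "0 \<le> E (\<lambda>x. q i x * ((\<phi> (g (flip i x)) - \<phi> (g x)) * (g (flip i x) - g x)))"
    if "i \<in> {1..n}" for i
    by (intro E_nonneg mult_nonneg_nonneg[OF rate_nonneg[OF that]])
  hence "0 \<le> (\<Sum>i=1..n. E (\<lambda>x. q i x * ((\<phi> (g (flip i x)) - \<phi> (g x)) * (g (flip i x) - g x))))"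
    by (intro sum_nonneg) auto
  thus ?thesis using dirichlet_form[of "\<lambda>x. \<phi> (g x)" g] by simp
qed

lemma wGamma_sum: "wGamma n q w f x = (\<Sum>i=1..n. (wdelta q w i f x)\<^sup>2)"
  by (simp add: wGamma_def L2_set_def sum_nonneg)

lemma wdelta_square:
  assumes "i \<in> {1..n}" "x \<in> cube n" "0 \<le> w i x"
  shows "(wdelta q w i f x)\<^sup>2 = w i x * (1/2 * q i x * (f (flip i x) - f x)\<^sup>2)"
  using assms rate_nonneg[OF assms(1,2)]
  by (simp add: wdelta_def power_mult_distrib)

lemma E_mult_gen_self: "E (\<lambda>x. g x * gen n q g x) = - E (Gamma_op n q g)"
proof -
  have "E (Gamma_op n q g) = (\<Sum>i=1..n. E (\<lambda>x. (wdelta q (\<lambda>i x. 1) i g x)\<^sup>2))"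
    unfolding wGamma_sum by (rule Bochner_Integration.integral_sum) (rule integrable)
  also have "\<dots> = (\<Sum>i=1..n. 1/2 *
      E (\<lambda>x. q i x * ((g (flip i x) - g x) * (g (flip i x) - g x))))"
  proof (intro sum.cong refl)
    fix i assume i: "i \<in> {1..n}"
    have "E (\<lambda>x. (wdelta q (\<lambda>i x. 1) i g x)\<^sup>2)
        = E (\<lambda>x. 1/2 * (q i x * ((g (flip i x) - g x) * (g (flip i x) - g x))))"
      by (intro E_cong) (simp add: wdelta_square[OF i], simp add: power2_eq_square)
    thus "E (\<lambda>x. (wdelta q (\<lambda>i x. 1) i g x)\<^sup>2)
        = 1/2 * E (\<lambda>x. q i x * ((g (flip i x) - g x) * (g (flip i x) - g x)))" by simp
  qed
  finally show ?thesis
    unfolding dirichlet_form[of g g] by (simp add: sum_distrib_left sum_negf)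
qed

text \<open>
  The existence of one \<open>C\<close> for all \<open>f\<close> expresses that the generator is bounded in the
  supremum norm over the cube; it makes the exponential series converge.
\<close>

lemma gen_power_bound:
  "\<exists>C. \<forall>f M. (\<forall>x\<in>cube n. \<bar>f x\<bar> \<le> M) \<longrightarrow>
       (\<forall>k. \<forall>x\<in>cube n. \<bar>(gen n q ^^ k) f x\<bar> \<le> M * C ^ k)"
proof -
  define C where "C = (\<Sum>i=1..n. \<Sum>y\<in>cube n. 2 * \<bar>q i y\<bar>)"
  have step: "\<bar>gen n q g x\<bar> \<le> K * C"
    if g: "\<forall>x\<in>cube n. \<bar>g x\<bar> \<le> K" and x: "x \<in> cube n" for g K x
  proof -
    have K: "K \<ge> 0" using g x by (smt (verit))
    have "\<bar>gen n q g x\<bar> \<le> (\<Sum>i=1..n. \<bar>q i x * (g (flip i x) - g x)\<bar>)"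
      unfolding gen_def by (rule sum_abs)
    also have "\<dots> \<le> (\<Sum>i=1..n. (\<Sum>y\<in>cube n. 2 * \<bar>q i y\<bar>) * K)"
    proof (intro sum_mono)
      fix i assume i: "i \<in> {1..n}"
      have "\<bar>g (flip i x) - g x\<bar> \<le> 2 * K"
        using g x flip_in_cube[OF i x] by (smt (verit))
      hence "\<bar>q i x\<bar> * \<bar>g (flip i x) - g x\<bar> \<le> \<bar>q i x\<bar> * (2 * K)"
        by (intro mult_left_mono) auto
      also have "\<dots> = (2 * \<bar>q i x\<bar>) * K" by simp
      also have "\<dots> \<le> (\<Sum>y\<in>cube n. 2 * \<bar>q i y\<bar>) * K"
        by (intro mult_right_mono K member_le_sum x finite_cube) auto
      finally show "\<bar>q i x * (g (flip i x) - g x)\<bar> \<le> (\<Sum>y\<in>cube n. 2 * \<bar>q i y\<bar>) * K"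
        by (simp add: abs_mult)
    qed
    finally show ?thesis by (simp add: C_def sum_distrib_left sum_distrib_right mult.commute)
  qed
  have "\<forall>x\<in>cube n. \<bar>(gen n q ^^ k) f x\<bar> \<le> M * C ^ k" if "\<forall>x\<in>cube n. \<bar>f x\<bar> \<le> M" for f M k
  proof (induction k)
    case 0 thus ?case using that by simp
  next
    case (Suc k)
    show ?case using step[OF Suc] by (simp add: mult_ac)
  qed
  thus ?thesis by blast
qed

lemma semigroup_DERIV:
  assumes x: "x \<in> cube n"
  shows "((\<lambda>s. P s f x) has_real_derivative gen n q (P t f) x) (at t)"
proof -
  obtain C where C: "\<And>f M k x. (\<forall>x\<in>cube n. \<bar>f x\<bar> \<le> M) \<Longrightarrow> x \<in> cube n \<Longrightarrow>
      \<bar>(gen n q ^^ k) f x\<bar> \<le> M * C ^ k"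
    using gen_power_bound by blast
  have M: "\<forall>x\<in>cube n. \<bar>f x\<bar> \<le> (\<Sum>y\<in>cube n. \<bar>f y\<bar>)"
    by (auto intro!: member_le_sum[of _ _ "\<lambda>y. \<bar>f y\<bar>"] finite_cube)
  note sm = DERIV_exponential_series(1)[OF C[OF M]]
  have "((\<lambda>s. P s f x) has_real_derivative (\<Sum>k. t ^ k / fact k * (gen n q ^^ Suc k) f x)) (at t)"
    unfolding semigroup_op_def by (rule DERIV_exponential_series(2)[OF C[OF M x]])
  moreover have "(\<Sum>k. t ^ k / fact k * (gen n q ^^ Suc k) f x) = gen n q (P t f) x"
  proof -
    have sums: "(\<lambda>k. t ^ k / fact k * (gen n q ^^ k) f y) sums P t f y" if "y \<in> cube n" for y
      unfolding semigroup_op_def by (rule summable_sums[OF sm[OF that]])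
    have "(\<lambda>k. \<Sum>i=1..n. q i x * (t ^ k / fact k * (gen n q ^^ k) f (flip i x)
              - t ^ k / fact k * (gen n q ^^ k) f x)) sums
          (\<Sum>i=1..n. q i x * (P t f (flip i x) - P t f x))"
      by (intro sums_sum sums_mult sums_diff sums x flip_in_cube)
    hence "(\<lambda>k. t ^ k / fact k * (gen n q ^^ Suc k) f x) sums gen n q (P t f) x"
      by (simp add: gen_def sum_distrib_left algebra_simps)
    thus ?thesis by (rule sums_unique[symmetric])
  qed
  ultimately show ?thesis by simp
qed

lemma semigroup_0: "P 0 f x = f x"
proof -
  have "P 0 f x = (\<Sum>k. if k = 0 then f x else 0)"
    unfolding semigroup_op_def by (intro suminf_cong) auto
  thus ?thesis using suminf_finite[of "{0}" "\<lambda>k. if k = 0 then f x else (0::real)"] by simp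
qed

lemma E_semigroup_DERIV:
  assumes \<Phi>: "\<And>y. (\<Phi> has_real_derivative \<phi> y) (at y)"
  shows "((\<lambda>s. E (\<lambda>x. \<Phi> (P s f x))) has_real_derivative
           E (\<lambda>x. \<phi> (P t f x) * gen n q (P t f) x)) (at t)"
proof -
  have "((\<lambda>s. \<Phi> (P s f x)) has_real_derivative \<phi> (P t f x) * gen n q (P t f) x) (at t)"
    if "x \<in> cube n" for x
    by (rule DERIV_chain2[OF \<Phi> semigroup_DERIV[OF that]])
  thus ?thesis unfolding E_sum by (intro DERIV_sum DERIV_cmult)
qed

text \<open>
  A differentiable function with monotone derivative is convex. The cases used are the identity and
  its negative (conservation of the mean), the square (contraction in \<open>L\<^sup>2\<close>) and the squared
  negative part (positivity).
\<close>

lemma E_semigroup_convex_le: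
  assumes \<Phi>: "\<And>y. (\<Phi> has_real_derivative \<phi> y) (at y)" and "mono \<phi>" and t: "t \<ge> 0"
  shows "E (\<lambda>x. \<Phi> (P t f x)) \<le> E (\<lambda>x. \<Phi> (f x))"
proof -
  have "E (\<lambda>x. \<Phi> (P t f x)) \<le> E (\<lambda>x. \<Phi> (P 0 f x))"
    using E_semigroup_DERIV[OF \<Phi>] E_mono_mult_gen_nonpos[OF \<open>mono \<phi>\<close>]
    by (intro DERIV_nonpos_imp_nonincreasing[OF t]) blast
  thus ?thesis by (simp add: semigroup_0)
qed

lemma E_semigroup:
  assumes "t \<ge> 0"
  shows "E (P t f) = E f"
  using E_semigroup_convex_le[of "\<lambda>y. y" "\<lambda>y. 1" t f]
    E_semigroup_convex_le[of "\<lambda>y. - y" "\<lambda>y. - 1" t f] assms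
  by (simp add: mono_def DERIV_minus)

lemma square_DERIV: "((\<lambda>y::real. y\<^sup>2) has_real_derivative 2 * y) (at y)"
  by (auto intro!: derivative_eq_intros)

lemma E_square_semigroup_le:
  assumes "t \<ge> 0"
  shows "E (\<lambda>x. (P t f x)\<^sup>2) \<le> E (\<lambda>x. (f x)\<^sup>2)"
  by (rule E_semigroup_convex_le[OF square_DERIV _ assms]) (simp add: mono_def)

lemma E_square_semigroup_DERIV:
  "((\<lambda>s. E (\<lambda>x. (P s f x)\<^sup>2)) has_real_derivative - 2 * E (Gamma_op n q (P t f))) (at t)"
  using E_semigroup_DERIV[OF square_DERIV, of f t] E_mult_gen_self[of "P t f"]
  by (simp add: mult.assoc)

text \<open>
  The mean of the squared negative part of \<open>P t f\<close> does not increase in \<open>t\<close> and starts at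
  zero. Being a statement about a mean, this only sees the support of \<open>\<mu>\<close>.
\<close>

lemma semigroup_nonneg:
  assumes f: "\<And>x. x \<in> cube n \<Longrightarrow> 0 \<le> f x" and t: "t \<ge> 0" and x: "x \<in> set_pmf \<mu>"
  shows "0 \<le> P t f x"
proof -
  define \<Phi> where "\<Phi> y = y\<^sup>2 - y * \<bar>y\<bar>" for y :: real
  have \<Phi>_nonneg: "0 \<le> \<Phi> y" for y
    by (cases "y \<ge> 0") (auto simp: \<Phi>_def power2_eq_square mult_nonpos_nonneg)
  have "E (\<lambda>x. \<Phi> (P t f x)) \<le> E (\<lambda>x. \<Phi> (f x))"
    unfolding \<Phi>_def
    by (rule E_semigroup_convex_le[OF has_derivative_square_minus_mult_abs _ t])
       (auto simp: mono_def abs_if)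
  also have "\<dots> = E (\<lambda>x. 0)"
    by (rule E_cong) (simp add: \<Phi>_def f power2_eq_square)
  finally have "(\<Sum>x\<in>cube n. pmf \<mu> x * \<Phi> (P t f x)) \<le> 0" by (simp add: E_sum)
  moreover have xc: "x \<in> cube n" using x support by auto
  have "pmf \<mu> x * \<Phi> (P t f x) \<le> (\<Sum>x\<in>cube n. pmf \<mu> x * \<Phi> (P t f x))"
    by (rule member_le_sum[OF xc]) (auto simp: \<Phi>_nonneg finite_cube)
  ultimately have "pmf \<mu> x * \<Phi> (P t f x) \<le> 0" by linarith
  moreover have "pmf \<mu> x > 0" using x by (simp add: pmf_positive)
  ultimately have "\<Phi> (P t f x) \<le> 0" by (simp add: mult_le_0_iff)
  thus ?thesis
  proof (rule contrapos_pp)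
    assume "\<not> 0 \<le> P t f x"
    hence "\<Phi> (P t f x) = 2 * (P t f x)\<^sup>2" "P t f x \<noteq> 0" by (auto simp: \<Phi>_def power2_eq_square)
    thus "\<not> \<Phi> (P t f x) \<le> 0" by simp
  qed
qed

end

section \<open>Consequences of the log-Sobolev inequality\<close>

locale log_sobolev_cube = reversible_cube +
  fixes \<rho> :: real
  assumes \<rho>_pos: "0 < \<rho>" and lsi: "log_sobolev n \<mu> q \<rho>"
begin

lemma Gamma_ge_entropy: "\<rho> / 2 * Ent \<mu> (\<lambda>x. (f x)\<^sup>2) \<le> E (Gamma_op n q f)"
proof -
  have "Ent \<mu> (\<lambda>x. (f x)\<^sup>2) \<le> 2 / \<rho> * E (Gamma_op n q f)"
    using lsi by (simp add: log_sobolev_def)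
  thus ?thesis using \<rho>_pos by (simp add: field_simps)
qed

lemma Gamma_ge_log_ratio:
  assumes "\<And>x. x \<in> set_pmf \<mu> \<Longrightarrow> 0 \<le> h x" and m: "0 < E h"
  shows "\<rho> / 2 * (E (\<lambda>x. (h x)\<^sup>2) * ln (E (\<lambda>x. (h x)\<^sup>2) / (E h)\<^sup>2)) \<le> E (Gamma_op n q h)"
proof -
  have "0 < (E h)\<^sup>2" using m by simp
  also have "\<dots> \<le> E (\<lambda>x. (h x)\<^sup>2)" by (rule square_E_le)
  finally have "E (\<lambda>x. (h x)\<^sup>2) * ln (E (\<lambda>x. (h x)\<^sup>2) / (E h)\<^sup>2) \<le> Ent \<mu> (\<lambda>x. (h x)\<^sup>2)"
    by (intro entropy_square_ge finite_support assms)
  hence "\<rho> / 2 * (E (\<lambda>x. (h x)\<^sup>2) * ln (E (\<lambda>x. (h x)\<^sup>2) / (E h)\<^sup>2))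
       \<le> \<rho> / 2 * Ent \<mu> (\<lambda>x. (h x)\<^sup>2)"
    using \<rho>_pos by (intro mult_left_mono) auto
  thus ?thesis using Gamma_ge_entropy[of h] by linarith
qed

text \<open>
  The entropy bound for the nonnegative perturbation \<open>1 + \<epsilon> (f - E f)\<close> of the constant, whose mean
  is 1 and whose second moment is \<open>1 + \<epsilon>\<^sup>2 Var f\<close>. Letting \<open>\<epsilon>\<close> tend to zero in the
  log-Sobolev inequality itself would give the constant \<open>\<rho>\<close>; half of it suffices and any
  admissible \<open>\<epsilon>\<close> will do.
\<close>

lemma poincare: "\<rho> / 2 * measure_pmf.variance \<mu> f \<le> E (Gamma_op n q f)"
proof -
  define V where "V = measure_pmf.variance \<mu> f"
  \<comment> \<open>small enough that \<open>h\<close> is nonnegative on the whole cube\<close>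
  define \<epsilon> where "\<epsilon> = 1 / (1 + (\<Sum>x\<in>cube n. \<bar>f x - E f\<bar>))"
  define h where "h x = 1 + \<epsilon> * (f x - E f)" for x
  have den: "0 < 1 + (\<Sum>x\<in>cube n. \<bar>f x - E f\<bar>)"
    by (smt (verit) sum_nonneg abs_ge_zero)
  have \<epsilon>: "\<epsilon> > 0" using den by (simp add: \<epsilon>_def)
  have "0 \<le> h x" if "x \<in> set_pmf \<mu>" for x
  proof -
    have "\<bar>f x - E f\<bar> \<le> (\<Sum>x\<in>cube n. \<bar>f x - E f\<bar>)"
      using that support by (intro member_le_sum[of _ _ "\<lambda>x. \<bar>f x - E f\<bar>"] finite_cube) auto
    hence "\<epsilon> * \<bar>f x - E f\<bar> \<le> 1" using den by (simp add: \<epsilon>_def field_simps)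
    moreover have "- (\<epsilon> * \<bar>f x - E f\<bar>) \<le> \<epsilon> * (f x - E f)"
      using \<epsilon> by (metis abs_ge_minus_self abs_mult abs_of_pos minus_le_iff)
    ultimately show ?thesis by (simp add: h_def)
  qed
  moreover have Eh: "E h = 1" by (simp add: h_def[abs_def] integrable)
  moreover have Eh2: "E (\<lambda>x. (h x)\<^sup>2) = 1 + \<epsilon>\<^sup>2 * V"
  proof -
    have "measure_pmf.variance \<mu> h = \<epsilon>\<^sup>2 * V"
      unfolding Eh by (simp add: h_def V_def power_mult_distrib)
    thus ?thesis using variance_eq[of h] Eh by simp
  qed
  ultimately have "\<rho> / 2 * ((1 + \<epsilon>\<^sup>2 * V) * ln (1 + \<epsilon>\<^sup>2 * V)) \<le> E (Gamma_op n q h)"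
    using Gamma_ge_log_ratio[of h] by simp
  moreover have "\<rho> / 2 * (\<epsilon>\<^sup>2 * V) \<le> \<rho> / 2 * ((1 + \<epsilon>\<^sup>2 * V) * ln (1 + \<epsilon>\<^sup>2 * V))"
    using \<rho>_pos by (intro mult_left_mono self_le_one_plus_mult_ln) (auto simp: V_def E_nonneg)
  moreover have "E (Gamma_op n q h) = \<epsilon>\<^sup>2 * E (Gamma_op n q f)"
  proof -
    have "wdelta q (\<lambda>i x. 1) i h x = \<epsilon> * wdelta q (\<lambda>i x. 1) i f x" for i x
      by (simp add: wdelta_def h_def algebra_simps)
    hence "Gamma_op n q h = (\<lambda>x. \<epsilon>\<^sup>2 * Gamma_op n q f x)"
      by (simp add: fun_eq_iff wGamma_sum power_mult_distrib sum_distrib_left)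
    thus ?thesis by simp
  qed
  ultimately have "\<epsilon>\<^sup>2 * (\<rho> / 2 * V) \<le> \<epsilon>\<^sup>2 * E (Gamma_op n q f)"
    by (simp add: mult_ac)
  thus ?thesis using \<epsilon> by (simp add: V_def)
qed

lemma variance_decay:
  assumes t: "t \<ge> 0"
  shows "measure_pmf.variance \<mu> (P t f) \<le> exp (- \<rho> * t) * measure_pmf.variance \<mu> f"
proof -
  define y where "y s = E (\<lambda>x. (P s f x)\<^sup>2) - (E f)\<^sup>2" for s
  have var: "measure_pmf.variance \<mu> (P s f) = y s" if "s \<ge> 0" for s
    using variance_eq[of "P s f"] E_semigroup[OF that, of f] by (simp add: y_def)
  have "y t \<le> exp (- \<rho> * t) * y 0"
  proof (rule differential_decay[OF _ _ t])
    show "(y has_real_derivative - 2 * E (Gamma_op n q (P s f))) (at s)" for s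
      unfolding y_def using DERIV_diff[OF E_square_semigroup_DERIV DERIV_const] by simp
    show "- 2 * E (Gamma_op n q (P s f)) \<le> - \<rho> * y s" if "s \<ge> 0" for s
      using poincare[of "P s f"] unfolding var[OF that] by linarith
  qed
  moreover have "y 0 = measure_pmf.variance \<mu> f"
    unfolding variance_eq y_def by (simp add: semigroup_0)
  ultimately show ?thesis using var[OF t] by simp
qed

text \<open>
  This replaces hypercontractivity. With \<open>m\<close> the conserved mean and \<open>u\<close> the second moment, the
  quantity \<open>v = ln (u / m\<^sup>2)\<close> satisfies \<open>v' \<le> - \<rho> v\<close>, because the log-Sobolev inequality
  and the entropy bound give \<open>u' \<le> - \<rho> u v\<close>. If \<open>E g = 0\<close>, the logarithm is zero by
  the conventions for division by zero and \<open>ln 0\<close>, and the claim is the contraction in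
  \<open>L\<^sup>2\<close>.
\<close>

lemma E_square_semigroup_l1_l2:
  assumes g: "\<And>x. x \<in> cube n \<Longrightarrow> 0 \<le> g x" and t: "0 \<le> t" "\<rho> * t \<le> 1"
  shows "E (\<lambda>x. (P t g x)\<^sup>2) \<le>
           E (\<lambda>x. (g x)\<^sup>2) * exp (- \<rho> * t * ln (sqrt (E (\<lambda>x. (g x)\<^sup>2)) / E g))"
proof (cases "E g = 0")
  case True
  thus ?thesis using E_square_semigroup_le[OF t(1)] by simp
next
  case False
  define m where "m = E g"
  define u where "u s = E (\<lambda>x. (P s g x)\<^sup>2)" for s
  define v where "v s = ln (u s / m\<^sup>2)" for s
  have m: "m > 0" using False E_nonneg[of g] g by (simp add: m_def less_le)
  have u_ge: "m\<^sup>2 \<le> u s" if "s \<ge> 0" for s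
    using square_E_le[of "P s g"] E_semigroup[OF that] by (simp add: u_def m_def)
  have u_pos: "u s > 0" if "s \<ge> 0" for s
    using u_ge[OF that] m by (smt (verit) zero_less_power)
  have v_decay: "v t \<le> exp (- \<rho> * t) * v 0"
  proof (rule differential_decay[OF _ _ t(1)])
    fix s :: real assume s: "s \<ge> 0"
    have du: "(u has_real_derivative - 2 * E (Gamma_op n q (P s g))) (at s)"
      unfolding u_def by (rule E_square_semigroup_DERIV)
    have "0 < u s / m\<^sup>2" using u_pos[OF s] m by simp
    note * = DERIV_chain2[OF DERIV_ln_divide[OF this] DERIV_cdivide[OF du]]
    show "(v has_real_derivative - 2 * E (Gamma_op n q (P s g)) / u s) (at s)"
      using m * by (simp add: v_def[abs_def])
    have "\<rho> / 2 * (u s * v s) \<le> E (Gamma_op n q (P s g))"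
      using Gamma_ge_log_ratio[of "P s g"] semigroup_nonneg[of g, OF g s] m E_semigroup[OF s, of g]
      by (simp add: u_def v_def m_def)
    thus "- 2 * E (Gamma_op n q (P s g)) / u s \<le> - \<rho> * v s"
      using u_pos[OF s] by (simp add: field_simps)
  qed
  define l where "l = ln (sqrt (u 0) / m)"
  have v0: "v 0 = 2 * l"
    using m u_pos[of 0] by (simp add: v_def l_def ln_div ln_sqrt ln_realpow)
  have "v 0 \<ge> 0" using u_ge[of 0] m by (simp add: v_def)
  hence "(\<rho> * t / 2) * v 0 \<le> (1 - exp (- (\<rho> * t))) * v 0"
    using t \<rho>_pos by (intro mult_right_mono one_minus_exp_ge_half) auto
  hence "v t \<le> v 0 + (- \<rho> * t * l)"
    using v_decay by (simp add: v0 algebra_simps)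
  hence "exp (v t) \<le> exp (v 0) * exp (- \<rho> * t * l)"
    by (simp add: exp_add[symmetric])
  hence "u t / m\<^sup>2 \<le> u 0 / m\<^sup>2 * exp (- \<rho> * t * l)"
    using u_pos[OF t(1)] u_pos[of 0] m by (simp add: v_def)
  hence "u t \<le> u 0 * exp (- \<rho> * t * l)"
    using m by (simp add: field_simps)
  thus ?thesis by (simp add: u_def l_def m_def semigroup_0)
qed

end

section \<open>Influence inequalities\<close>

locale csge_cube = log_sobolev_cube +
  fixes w :: "nat \<Rightarrow> config \<Rightarrow> real" and b \<rho>' \<kappa> :: real
  assumes w_bounded: "b_bounded n w b" and b_pos: "0 < b"
    and csge: "CSGE0 n q w \<rho>'" and \<kappa>: "\<kappa> = max (- \<rho>') 0"
begin

abbreviation "infl \<equiv> influence \<mu> q w"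
abbreviation "l1_infl i f \<equiv> E (abs_wdelta q w i f)"
abbreviation "infl_ratio i f \<equiv> ln (sqrt (infl i f) / l1_infl i f)"

lemma weight_bounds:
  assumes "i \<in> {1..n}" "x \<in> cube n"
  shows "b \<le> w i x" "w i x \<le> 1 / b" "0 \<le> w i x"
proof -
  show "b \<le> w i x" "w i x \<le> 1 / b" using w_bounded assms by (auto simp: b_bounded_def)
  thus "0 \<le> w i x" using b_pos by linarith
qed

lemma influence_eq: "infl i f = E (\<lambda>x. (abs_wdelta q w i f x)\<^sup>2)"
  by (simp add: influence_def abs_wdelta_def)

lemma influence_nonneg: "0 \<le> infl i f"
  unfolding influence_def by (rule E_nonneg) simp

lemma l1_infl_nonneg: "0 \<le> l1_infl i f"
  by (rule E_nonneg) (simp add: abs_wdelta_def)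

lemma l1_infl_square_le: "(l1_infl i f)\<^sup>2 \<le> infl i f"
  unfolding influence_eq by (rule square_E_le)

lemma influence_eq_0:
  assumes "l1_infl i f = 0"
  shows "infl i f = 0"
proof -
  have "AE x in measure_pmf \<mu>. abs_wdelta q w i f x = 0"
    using assms integral_nonneg_eq_0_iff_AE[OF integrable, of "abs_wdelta q w i f"]
    by (simp add: abs_wdelta_def)
  hence "E (\<lambda>x. (abs_wdelta q w i f x)\<^sup>2) = E (\<lambda>x. 0)"
    by (intro integral_cong_AE) auto
  thus ?thesis by (simp add: influence_eq)
qed

lemma infl_ratio_nonneg: "0 \<le> infl_ratio i f"
proof (cases "l1_infl i f = 0")
  case False
  hence "0 < l1_infl i f" using l1_infl_nonneg[of i f] by simp
  moreover have "l1_infl i f \<le> sqrt (infl i f)"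
    by (rule real_le_rsqrt[OF l1_infl_square_le])
  ultimately show ?thesis by simp
qed simp

lemma wdelta_square_compare:
  assumes i: "i \<in> {1..n}" and x: "x \<in> cube n"
  shows "b * (wdelta q (\<lambda>i x. 1) i f x)\<^sup>2 \<le> (wdelta q w i f x)\<^sup>2"
    and "b * (wdelta q w i f x)\<^sup>2 \<le> (wdelta q (\<lambda>i x. 1) i f x)\<^sup>2"
proof -
  have nn: "0 \<le> 1/2 * q i x * (f (flip i x) - f x)\<^sup>2"
    using rate_nonneg[OF i x] by simp
  have "b * w i x \<le> 1" using weight_bounds[OF i x] b_pos by (simp add: field_simps)
  note wb = weight_bounds[OF i x] this
  show "b * (wdelta q (\<lambda>i x. 1) i f x)\<^sup>2 \<le> (wdelta q w i f x)\<^sup>2"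
    using mult_right_mono[OF wb(1) nn] wb(3) by (simp add: wdelta_square[OF i x])
  show "b * (wdelta q w i f x)\<^sup>2 \<le> (wdelta q (\<lambda>i x. 1) i f x)\<^sup>2"
    using mult_right_mono[OF wb(4) nn] wb(3) by (simp add: wdelta_square[OF i x] mult.assoc)
qed

lemma Gamma_le_wGamma:
  assumes "x \<in> cube n"
  shows "b * Gamma_op n q f x \<le> wGamma n q w f x"
  unfolding wGamma_sum sum_distrib_left
  by (intro sum_mono wdelta_square_compare(1) assms)

lemma weighted_influence_le_total: "b * weighted_influence n \<mu> q w f \<le> total_influence n \<mu> q f"
proof -
  have "b * weighted_influence n \<mu> q w f = E (\<lambda>x. \<Sum>i=1..n. b * (wdelta q w i f x)\<^sup>2)"
    by (simp add: weighted_influence_def influence_def integrable sum_distrib_left)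
  also have "\<dots> \<le> E (Gamma_op n q f)"
    unfolding wGamma_sum by (intro E_mono sum_mono wdelta_square_compare(2))
  finally show ?thesis by (simp add: total_influence_def)
qed

text \<open>
  The commutation hypothesis squared. Replacing \<open>- \<rho>'\<close> by its positive part makes the factor
  monotone in \<open>t\<close>.
\<close>

lemma wGamma_semigroup_le:
  assumes x: "x \<in> cube n" and t: "t \<ge> 0"
  shows "wGamma n q w (P t f) x
       \<le> exp (2 * \<kappa> * t) * (\<Sum>i=1..n. (P t (abs_wdelta q w i f) x)\<^sup>2)"
proof -
  define R where "R = L2_set (\<lambda>i. P t (abs_wdelta q w i f) x) {1..n}"
  have "- \<rho>' * t \<le> \<kappa> * t" using t by (intro mult_right_mono) (auto simp: \<kappa>)
  have "L2_set (\<lambda>i. wdelta q w i (P t f) x) {1..n} \<le> exp (- \<rho>' * t) * R"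
    using csge x t by (simp add: CSGE0_def R_def)
  also have "\<dots> \<le> exp (\<kappa> * t) * R"
    using \<open>- \<rho>' * t \<le> \<kappa> * t\<close> by (intro mult_right_mono) (auto simp: R_def)
  finally have "wGamma n q w (P t f) x \<le> (exp (\<kappa> * t) * R)\<^sup>2"
    unfolding wGamma_def by (intro power_mono) auto
  also have "\<dots> = exp (2 * \<kappa> * t) * R\<^sup>2"
    by (simp add: power_mult_distrib exp_double[symmetric] mult_ac)
  also have "R\<^sup>2 = (\<Sum>i=1..n. (P t (abs_wdelta q w i f) x)\<^sup>2)"
    by (simp add: R_def L2_set_def sum_nonneg)
  finally show ?thesis .
qed

text \<open>
  On the time span considered, both \<open>\<kappa> t\<close> and \<open>\<rho> t\<close> are at most 1. So \<open>exp (2 \<kappa> t)\<close>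
  costs a factor \<open>exp 2\<close>, and another factor \<open>exp 1\<close> pays for replacing the decay rate
  \<open>\<rho> l\<^sub>i\<close>, which may vanish, by \<open>\<rho> (1 + l\<^sub>i)\<close>.
\<close>

lemma Gamma_semigroup_le:
  assumes t: "0 \<le> t" "(\<rho> + \<kappa>) * t \<le> 1"
  shows "b * E (Gamma_op n q (P t f))
       \<le> exp 3 * (\<Sum>i=1..n. infl i f * exp (- (\<rho> * (1 + infl_ratio i f)) * t))"
proof -
  have "\<kappa> \<ge> 0" by (simp add: \<kappa>)
  hence \<kappa>t: "0 \<le> \<kappa> * t" and \<rho>t: "0 \<le> \<rho> * t" using t \<rho>_pos by auto
  have le1: "\<kappa> * t \<le> 1" "\<rho> * t \<le> 1" using t(2) \<kappa>t \<rho>t by (auto simp: algebra_simps)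
  have one: "E (\<lambda>x. (P t (abs_wdelta q w i f) x)\<^sup>2)
      \<le> exp 1 * (infl i f * exp (- (\<rho> * (1 + infl_ratio i f)) * t))" for i
  proof -
    have "E (\<lambda>x. (P t (abs_wdelta q w i f) x)\<^sup>2) \<le> infl i f * exp (- \<rho> * t * infl_ratio i f)"
      unfolding influence_eq
      by (rule E_square_semigroup_l1_l2[OF _ t(1) le1(2)]) (simp add: abs_wdelta_def)
    also have "\<dots> \<le> infl i f * exp (1 - \<rho> * (1 + infl_ratio i f) * t)"
      using le1(2) by (intro mult_left_mono influence_nonneg) (auto simp: algebra_simps)
    also have "\<dots> = exp 1 * (infl i f * exp (- (\<rho> * (1 + infl_ratio i f)) * t))"
      using exp_add[of 1 "- (\<rho> * (1 + infl_ratio i f)) * t"] by simp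
    finally show ?thesis .
  qed
  have "b * E (Gamma_op n q (P t f)) = E (\<lambda>x. b * Gamma_op n q (P t f) x)" by simp
  also have "\<dots> \<le> E (\<lambda>x. exp (2 * \<kappa> * t) * (\<Sum>i=1..n. (P t (abs_wdelta q w i f) x)\<^sup>2))"
    using Gamma_le_wGamma wGamma_semigroup_le[OF _ t(1)] by (intro E_mono) (blast intro: order_trans)
  also have "\<dots> = exp (2 * \<kappa> * t) * (\<Sum>i=1..n. E (\<lambda>x. (P t (abs_wdelta q w i f) x)\<^sup>2))"
    by (simp add: integrable)
  also have "\<dots> \<le> exp 2 * (\<Sum>i=1..n. exp 1 * (infl i f * exp (- (\<rho> * (1 + infl_ratio i f)) * t)))"
    using le1(1) by (intro mult_mono sum_mono one sum_nonneg E_nonneg) auto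
  also have "\<dots> = exp 2 * exp 1 * (\<Sum>i=1..n. infl i f * exp (- (\<rho> * (1 + infl_ratio i f)) * t))"
    by (simp add: sum_distrib_left mult.assoc)
  also have "exp 2 * exp 1 = (exp 3 :: real)" by (simp add: exp_add[symmetric])
  finally show ?thesis .
qed

text \<open>
  The decay rate of the second moment is integrated over \<open>[0, T]\<close>. Instead of an integral, the
  proof uses that \<open>W\<close>, the second moment corrected by the primitive of the bound on its rate, is
  nondecreasing.
\<close>

theorem variance_le_sum_influences:
  "1 / (4 * exp 3) * measure_pmf.variance \<mu> f
     \<le> (\<rho> + \<kappa>) / (b * \<rho>\<^sup>2) * (\<Sum>i=1..n. infl i f / (1 + infl_ratio i f))"
proof -
  define V where "V = measure_pmf.variance \<mu> f"
  define S where "S = (\<Sum>i=1..n. infl i f / (1 + infl_ratio i f))"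
  define lam where "lam i = \<rho> * (1 + infl_ratio i f)" for i
  \<comment> \<open>short enough to keep \<open>exp (2 \<kappa> T)\<close> bounded, long enough to lose a fraction of order
    \<open>\<rho> T\<close> of the variance\<close>
  define T where "T = 1 / (\<rho> + \<kappa>)"
  define K where "K = 2 * exp 3 / b"
  define y where "y s = E (\<lambda>x. (P s f x)\<^sup>2)" for s
  define W where "W s = y s - K * (\<Sum>i=1..n. infl i f * exp (- lam i * s) / lam i)" for s
  have \<kappa>_nonneg: "\<kappa> \<ge> 0" by (simp add: \<kappa>)
  have sum_pos: "0 < \<rho> + \<kappa>" using \<rho>_pos \<kappa>_nonneg by simp
  have T_pos: "T > 0" using sum_pos by (simp add: T_def)
  have lam_pos: "lam i > 0" for i
    using \<rho>_pos infl_ratio_nonneg[of i f] by (simp add: lam_def add_pos_nonneg)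
  have K_pos: "K > 0" using b_pos by (simp add: K_def)
  have "W 0 \<le> W T"
  proof (rule DERIV_nonneg_imp_nondecreasing[of 0 T W])
    show "0 \<le> T" using T_pos by simp
    fix s assume s: "0 \<le> s" "s \<le> T"
    let ?D = "- 2 * E (Gamma_op n q (P s f)) + K * (\<Sum>i=1..n. infl i f * exp (- lam i * s))"
    have "((\<lambda>s. infl i f * exp (- lam i * s) / lam i) has_real_derivative
             - (infl i f * exp (- lam i * s))) (at s)" for i
      using lam_pos[of i] by (auto intro!: derivative_eq_intros)
    hence "((\<lambda>s. \<Sum>i=1..n. infl i f * exp (- lam i * s) / lam i) has_real_derivative
             (\<Sum>i=1..n. - (infl i f * exp (- lam i * s)))) (at s)"
      by (intro DERIV_sum)
    from DERIV_diff[OF E_square_semigroup_DERIV[of f s] DERIV_cmult[OF this, of K]]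
    have "(W has_real_derivative ?D) (at s)"
      by (simp add: W_def[abs_def] y_def sum_negf)
    moreover have "0 \<le> ?D"
    proof -
      have "(\<rho> + \<kappa>) * s \<le> (\<rho> + \<kappa>) * T" using s sum_pos by (intro mult_left_mono) auto
      also have "\<dots> = 1" using sum_pos by (simp add: T_def)
      finally have "b * E (Gamma_op n q (P s f))
          \<le> exp 3 * (\<Sum>i=1..n. infl i f * exp (- lam i * s))"
        unfolding lam_def by (rule Gamma_semigroup_le[OF s(1)])
      thus ?thesis using b_pos by (simp add: K_def field_simps)
    qed
    ultimately show "\<exists>d. (W has_real_derivative d) (at s) \<and> 0 \<le> d" by blast
  qed
  moreover have "W T \<le> y T"
    unfolding W_def using K_pos lam_pos
    by (auto intro!: mult_nonneg_nonneg sum_nonneg divide_nonneg_pos influence_nonneg)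
  moreover have "W 0 = y 0 - K * (S / \<rho>)"
    by (simp add: W_def S_def lam_def sum_divide_distrib field_simps)
  ultimately have drop: "y 0 - y T \<le> K * (S / \<rho>)" by linarith
  have "y 0 - y T = V - measure_pmf.variance \<mu> (P T f)"
    using E_semigroup[of T f] T_pos variance_eq[of f] variance_eq[of "P T f"]
    by (simp add: V_def y_def semigroup_0)
  moreover have "measure_pmf.variance \<mu> (P T f) \<le> exp (- \<rho> * T) * V"
    unfolding V_def using T_pos by (intro variance_decay) simp
  ultimately have "(1 - exp (- (\<rho> * T))) * V \<le> K * (S / \<rho>)"
    using drop by (simp add: algebra_simps)
  moreover have "\<rho> * T / 2 * V \<le> (1 - exp (- (\<rho> * T))) * V"
  proof (intro mult_right_mono one_minus_exp_ge_half)
    show "0 \<le> \<rho> * T" using T_pos \<rho>_pos by simp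
    show "\<rho> * T \<le> 1" using \<kappa>_nonneg sum_pos by (simp add: T_def)
    show "0 \<le> V" unfolding V_def by (rule E_nonneg) simp
  qed
  ultimately have "\<rho> * T / 2 * V \<le> K * (S / \<rho>)" by linarith
  hence "V * \<rho>\<^sup>2 * b \<le> 4 * exp 3 * (\<rho> + \<kappa>) * S"
    using \<rho>_pos b_pos sum_pos by (simp add: K_def T_def field_simps power2_eq_square)
  thus ?thesis
    using \<rho>_pos b_pos sum_pos unfolding V_def[symmetric] S_def[symmetric]
    by (simp add: field_simps)
qed

lemma l1_influence_sq_le: "l1_influence_sq n \<mu> q w f \<le> weighted_influence n \<mu> q w f"
  unfolding l1_influence_sq_def weighted_influence_def by (intro sum_mono l1_infl_square_le)

text \<open>
  Write \<open>B\<^sub>i = 1 + 2 l\<^sub>i\<close>, so that \<open>exp (1 - B\<^sub>i) = J\<^sub>i / I\<^sub>i\<close> with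
  \<open>J\<^sub>i\<close> the squared \<open>L\<^sup>1\<close> influence, and \<open>D = 1 + ln (I / J)\<close>. The function
  \<open>r \<mapsto> 1 / (1 - ln r)\<close> is not concave near 1, so Jensen's inequality does not apply to it.
  Its role is taken by \<open>1 / B \<le> (1 + exp (D - B)) / D\<close> for \<open>B \<ge> 1\<close>. Since
  \<open>exp (D - B\<^sub>i) = (I / J) (J\<^sub>i / I\<^sub>i)\<close>, the exponentials sum to the same amount
  as the main term, so this only costs a factor 2.
\<close>

lemma sum_influence_ratio_le:
  assumes J: "0 < l1_influence_sq n \<mu> q w f"
  shows "(\<Sum>i=1..n. infl i f / (1 + infl_ratio i f))
       \<le> 4 * weighted_influence n \<mu> q w f /
           (1 + ln (weighted_influence n \<mu> q w f / l1_influence_sq n \<mu> q w f))"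
proof -
  define I where "I = weighted_influence n \<mu> q w f"
  define J where "J = l1_influence_sq n \<mu> q w f"
  define D where "D = 1 + ln (I / J)"
  have pos: "0 < J" "0 < I" "J \<le> I" "1 \<le> D"
    using J l1_influence_sq_le[of f] by (auto simp: I_def J_def D_def)
  have one: "infl i f / (1 + infl_ratio i f)
      \<le> 2 / D * (infl i f + I / J * (l1_infl i f)\<^sup>2)" for i
  proof (cases "l1_infl i f = 0")
    case True
    hence "infl i f = 0" by (rule influence_eq_0)
    thus ?thesis using pos by simp
  next
    case False
    hence m: "0 < l1_infl i f" using l1_infl_nonneg[of i f] by simp
    hence "0 < (l1_infl i f)\<^sup>2" by simp
    hence Ii: "0 < infl i f" using l1_infl_square_le[of i f] by linarith
    define B where "B = 1 + 2 * infl_ratio i f"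
    have B: "1 \<le> B" using infl_ratio_nonneg[of i f] by (simp add: B_def)
    have "infl i f / (1 + infl_ratio i f) \<le> 2 * infl i f / B"
      using infl_ratio_nonneg[of i f] Ii by (simp add: B_def field_simps)
    also have "D \<le> B * (1 + exp (D - B))"
    proof -
      have "exp (D - B) \<le> B * exp (D - B)" using B by simp
      moreover have "1 + (D - B) \<le> exp (D - B)" by (rule exp_ge_add_one_self)
      ultimately have "D \<le> B + B * exp (D - B)" by linarith
      thus ?thesis by (simp add: algebra_simps)
    qed
    hence "2 * infl i f * D \<le> 2 * infl i f * (B * (1 + exp (D - B)))"
      using Ii by (intro mult_left_mono) auto
    hence "2 * infl i f / B \<le> 2 * infl i f * (1 + exp (D - B)) / D"
      using B pos by (simp add: divide_le_eq pos_le_divide_eq mult_ac)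
    also have "exp (D - B) = I / J * ((l1_infl i f)\<^sup>2 / infl i f)"
    proof -
      have "D - B = ln (I / J * ((l1_infl i f)\<^sup>2 / infl i f))"
        using m Ii pos by (simp add: D_def B_def ln_div ln_mult ln_sqrt ln_realpow)
      thus ?thesis using m Ii pos by simp
    qed
    finally have "infl i f / (1 + infl_ratio i f)
        \<le> 2 * infl i f * (1 + I / J * ((l1_infl i f)\<^sup>2 / infl i f)) / D" .
    also have "\<dots> = 2 / D * (infl i f + I / J * (l1_infl i f)\<^sup>2)"
      using Ii by (simp add: distrib_left add_divide_distrib mult_ac)
    finally show ?thesis .
  qed
  have "(\<Sum>i=1..n. infl i f / (1 + infl_ratio i f))
      \<le> (\<Sum>i=1..n. 2 / D * (infl i f + I / J * (l1_infl i f)\<^sup>2))"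
    by (intro sum_mono one)
  also have "\<dots> = 2 / D * (I + I / J * J)"
    unfolding I_def J_def weighted_influence_def l1_influence_sq_def
    by (simp only: sum_distrib_left[symmetric] sum.distrib)
  also have "\<dots> = 4 * I / D" using pos by simp
  finally show ?thesis by (simp add: I_def J_def D_def)
qed

theorem total_influence_ge:
  "1 / (16 * exp 3) * (b\<^sup>2 * \<rho>\<^sup>2 / (\<rho> + \<kappa>)) * measure_pmf.variance \<mu> f *
     (1 + ln (weighted_influence n \<mu> q w f / l1_influence_sq n \<mu> q w f))
   \<le> total_influence n \<mu> q f"
proof -
  define V where "V = measure_pmf.variance \<mu> f"
  define I where "I = weighted_influence n \<mu> q w f"
  define J where "J = l1_influence_sq n \<mu> q w f"
  define D where "D = 1 + ln (I / J)"
  have sum_pos: "0 < \<rho> + \<kappa>" using \<rho>_pos by (simp add: \<kappa>)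
  have I_nonneg: "0 \<le> I" unfolding I_def weighted_influence_def by (intro sum_nonneg influence_nonneg)
  have total: "b * I \<le> total_influence n \<mu> q f"
    unfolding I_def by (rule weighted_influence_le_total)
  have V_nonneg: "0 \<le> V" unfolding V_def by (rule E_nonneg) simp
  define S where "S = (\<Sum>i=1..n. infl i f / (1 + infl_ratio i f))"
  have "V \<le> 4 * exp 3 * ((\<rho> + \<kappa>) / (b * \<rho>\<^sup>2) * S)"
    using variance_le_sum_influences[of f] by (simp add: V_def S_def field_simps)
  also have "\<dots> = 4 * exp 3 * (\<rho> + \<kappa>) * S / (b * \<rho>\<^sup>2)" by simp
  finally have VS: "b * \<rho>\<^sup>2 * V \<le> 4 * exp 3 * (\<rho> + \<kappa>) * S"
    using b_pos \<rho>_pos by (simp add: field_simps)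
  have "b * \<rho>\<^sup>2 * V * D \<le> 16 * exp 3 * (\<rho> + \<kappa>) * I"
  proof (cases "J = 0")
    case True
    \<comment> \<open>Here \<open>D\<close> is a default value; all influences vanish, and by the first inequality so
      does the variance.\<close>
    have "infl i f = 0" if "i \<in> {1..n}" for i
      using True that unfolding J_def l1_influence_sq_def
      by (intro influence_eq_0) (simp add: sum_nonneg_eq_0_iff)
    hence "S = 0" by (simp add: S_def)
    hence "V * (b * \<rho>\<^sup>2) \<le> 0" using VS by (simp add: mult_ac)
    moreover have "b * \<rho>\<^sup>2 > 0" using b_pos \<rho>_pos by simp
    ultimately have "V = 0" using V_nonneg by (smt (verit) mult_pos_pos)
    thus ?thesis using I_nonneg sum_pos by simp
  next
    case False
    hence J: "0 < J"
      unfolding J_def l1_influence_sq_def by (simp add: sum_nonneg less_le)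
    hence D: "1 \<le> D" using l1_influence_sq_le[of f] by (simp add: D_def I_def J_def)
    have "S \<le> 4 * I / D"
      unfolding S_def D_def I_def J_def by (rule sum_influence_ratio_le) (use J in \<open>simp add: J_def\<close>)
    hence SD: "S * D \<le> 4 * I" using D by (simp add: field_simps)
    have "b * \<rho>\<^sup>2 * V * D \<le> 4 * exp 3 * (\<rho> + \<kappa>) * S * D"
      using VS D by (intro mult_right_mono) auto
    also have "\<dots> = 4 * exp 3 * (\<rho> + \<kappa>) * (S * D)" by (simp add: mult.assoc)
    also have "\<dots> \<le> 4 * exp 3 * (\<rho> + \<kappa>) * (4 * I)"
      using SD sum_pos by (intro mult_left_mono) auto
    finally show ?thesis by simp
  qed
  hence "b * (b * \<rho>\<^sup>2 * V * D) \<le> b * (16 * exp 3 * (\<rho> + \<kappa>) * I)"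
    using b_pos by (intro mult_left_mono) auto
  also have "\<dots> = 16 * exp 3 * (\<rho> + \<kappa>) * (b * I)" by simp
  also have "\<dots> \<le> 16 * exp 3 * (\<rho> + \<kappa>) * total_influence n \<mu> q f"
    using total sum_pos by (intro mult_left_mono) auto
  finally have "b * (b * \<rho>\<^sup>2 * V * D) / (16 * exp 3 * (\<rho> + \<kappa>)) \<le> total_influence n \<mu> q f"
    using sum_pos by (simp add: pos_divide_le_eq mult.commute)
  thus ?thesis
    unfolding V_def[symmetric] I_def[symmetric] J_def[symmetric] D_def[symmetric]
    by (simp add: power2_eq_square mult_ac)
qed

end

theorem theorem5p4:
  "\<exists>c::real. c > 0 \<and>
    (\<forall>(n::nat) (\<mu>::config pmf) (q::nat \<Rightarrow> config \<Rightarrow> real) (w::nat \<Rightarrow> config \<Rightarrow> real)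
       (b::real) (\<rho>_CSGE::real) (\<rho>_LSI::real) (\<kappa>0::real).
       set_pmf \<mu> \<subseteq> cube n \<longrightarrow>
       (\<forall>i\<in>{1..n}. \<forall>x\<in>cube n. q i x \<ge> 0) \<longrightarrow>
       reversible n \<mu> q \<longrightarrow>
       (\<forall>i\<in>{1..n}. \<forall>x\<in>cube n. w i x \<ge> 0) \<longrightarrow>
       0 < b \<longrightarrow> b \<le> 1 \<longrightarrow>
       b_bounded n w b \<longrightarrow>
       CSGE0 n q w \<rho>_CSGE \<longrightarrow>
       \<rho>_LSI > 0 \<longrightarrow>
       log_sobolev n \<mu> q \<rho>_LSI \<longrightarrow>
       \<kappa>0 = max (- \<rho>_CSGE) 0 \<longrightarrow>
       (\<forall>f :: config \<Rightarrow> real.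
          c * measure_pmf.variance \<mu> f \<le>
            (\<rho>_LSI + \<kappa>0) / (b * \<rho>_LSI\<^sup>2) *
            (\<Sum>i=1..n. if influence \<mu> q w i f = 0 then 0
               else influence \<mu> q w i f /
                 (1 + ln (sqrt (influence \<mu> q w i f) /
                          measure_pmf.expectation \<mu> (abs_wdelta q w i f)))) \<and>
          total_influence n \<mu> q f \<ge>
            c * (b\<^sup>2 * \<rho>_LSI\<^sup>2 / (\<rho>_LSI + \<kappa>0)) * measure_pmf.variance \<mu> f *
            (1 + ln (weighted_influence n \<mu> q w f / l1_influence_sq n \<mu> q w f))))"
proof (intro exI[of _ "1 / (16 * exp 3)"] conjI allI impI)
  show "(0::real) < 1 / (16 * exp 3)" by simp
next
  fix n :: nat and \<mu> :: "config pmf" and q w :: "nat \<Rightarrow> config \<Rightarrow> real"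
    and b \<rho>_CSGE \<rho>_LSI \<kappa>0 :: real and f :: "config \<Rightarrow> real"
  assume "set_pmf \<mu> \<subseteq> cube n" "\<forall>i\<in>{1..n}. \<forall>x\<in>cube n. q i x \<ge> 0" "reversible n \<mu> q"
    "0 < b" "b_bounded n w b" "CSGE0 n q w \<rho>_CSGE" "\<rho>_LSI > 0" "log_sobolev n \<mu> q \<rho>_LSI"
    "\<kappa>0 = max (- \<rho>_CSGE) 0"
  then interpret csge_cube n \<mu> q \<rho>_LSI w b \<rho>_CSGE \<kappa>0
    by unfold_locales auto
  have "0 \<le> measure_pmf.variance \<mu> f" by (rule E_nonneg) simp
  hence "1 / (16 * exp 3) * measure_pmf.variance \<mu> f \<le> 1 / (4 * exp 3) * measure_pmf.variance \<mu> f"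
    by (intro mult_right_mono) (auto simp: field_simps)
  also note variance_le_sum_influences[of f]
  also have "(\<Sum>i=1..n. infl i f / (1 + infl_ratio i f)) =
      (\<Sum>i=1..n. if infl i f = 0 then 0 else infl i f / (1 + infl_ratio i f))"
    by (intro sum.cong) auto
  finally show "1 / (16 * exp 3) * measure_pmf.variance \<mu> f \<le>
            (\<rho>_LSI + \<kappa>0) / (b * \<rho>_LSI\<^sup>2) *
            (\<Sum>i=1..n. if influence \<mu> q w i f = 0 then 0
               else influence \<mu> q w i f /
                 (1 + ln (sqrt (influence \<mu> q w i f) /
                          measure_pmf.expectation \<mu> (abs_wdelta q w i f))))" .
  show "total_influence n \<mu> q f \<ge>
            1 / (16 * exp 3) * (b\<^sup>2 * \<rho>_LSI\<^sup>2 / (\<rho>_LSI + \<kappa>0)) * measure_pmf.variance \<mu> f *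
            (1 + ln (weighted_influence n \<mu> q w f / l1_influence_sq n \<mu> q w f))"
    by (rule total_influence_ge)
qed

end
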